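(* Let $G$ be a countable group with a finite symmetric generating set $S$, let $\mathbb{G}=(V,E)$ be the associated Cayley graph, and let $\mathcal{G}$ be the Gromov-Hausdorff space of connected subgraphs of $\mathbb{G}$ containing the identity $1$, with its equivalence relation $\mathcal{R}$. Let $\mu$ be a Borel probability measure on $\mathcal{G}$ such that: (a) $\mu$ is $\mathcal{R}$-quasi-invariant (that is, $(\mathcal{G},\mu)$ is a nonsingular random subgraph of $\mathbb{G}$); (b) $\mu$ is insertion-tolerant; (c) the set of infinite states $\mathcal{G}_\infty=\{\mathbb{H}\in\mathcal{G} : \mathcal{R}[\mathbb{H}]\text{ is infinite}\}$ satisfies $\mu(\mathcal{G}_\infty)>0$, and the restriction of $\mu$ to $\mathcal{G}_\infty$ is $\mathcal{R}$-ergodic, i.e. the conditional probability measure $\mu_\infty=\mu(\,\cdot\mid\mathcal{G}_\infty)$ is $\mathcal{R}$-ergodic. Let $\mathbb{H}\in\mathcal{G}$ be a proper repetitive subgraph of $\mathbb{G}$ (so $\mathbb{H}\neq\mathbb{G}$), and let $Z=\overline{\mathcal{R}[\mathbb{H}]}\subset\mathcal{G}$ be its orbit closure. Then $\mu_\infty$ and $Z$ are mutually singular, i.e. $\mu_\infty(Z)=0$ (equivalently, $\mu_\infty$ is mutually singular with every Borel probability measure on $\mathcal{G}$ concentrated on $Z$).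
   Context: Cayley graph: $V=G$ and $E=\{(g,h)\in G\times G : hg^{-1}\in S\}$. Since $S$ is symmetric, $E$ is a symmetric relation and $\mathbb{G}$ is regarded as an undirected graph. $G$ acts on the right by graph automorphisms, by right multiplication on $V$ and by the diagonal right multiplication on $E$. Gromov-Hausdorff space: $\mathcal{G}$ is the set of all connected subgraphs $\mathbb{H}$ of $\mathbb{G}$ that contain the identity $1\in G$ as a vertex, with the ultrametric $d(\mathbb{H},\mathbb{H}')=1/\exp(\sup\{r\ge 0 : B_{\mathbb{H}}(1,r)=B_{\mathbb{H}'}(1,r)\})$ (equal to $0$ if the supremum is infinite), where $B_{\mathbb{H}}(1,r)$ is the combinatorial closed ball of radius $r$ centred at $1$ in $\mathbb{H}$ (as a subgraph). It carries the Borel $\sigma$-algebra of this topology. Equivalence relation: $\mathcal{R}=\{(\mathbb{H},\mathbb{H}')\in\mathcal{G}\times\mathcal{G} : \exists\, g\in G,\ \mathbb{H}'=g.\mathbb{H}\}$, where $g.\mathbb{H}=\mathbb{H}g^{-1}$ is the image of $\mathbb{H}$ under right multiplication by $g^{-1}$ (the condition $g.\mathbb{H}\in\mathcal{G}$ forces $g$ to be a vertex of $\mathbb{H}$). It is a countable Borel equivalence relation. $\mathcal{R}[\mathbb{H}]$ denotes the class of $\mathbb{H}$, and $\mathcal{R}[B]=\bigcup_{\mathbb{H}\in B}\mathcal{R}[\mathbb{H}]$ for $B\subset\mathcal{G}$. Quasi-invariance: a Borel probability measure $\mu$ on $\mathcal{G}$ is $\mathcal{R}$-quasi-invariant if for every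 partial transformation $\varphi:A\to B$ of $\mathcal{R}$ (a measurable bijection between Borel sets whose graph is contained in $\mathcal{R}$) and every Borel $A'\subset A$, $\mu(A')=0$ if and only if $\mu(\varphi(A'))=0$. Ergodicity: a Borel probability measure $\nu$ is $\mathcal{R}$-ergodic if $\nu(\mathcal{R}[B])\in\{0,1\}$ for every Borel set $B$. Insertion-tolerance: for a finite symmetric set $F\subset E$, let $i_F:\mathcal{G}\to\mathcal{G}$ send $\mathbb{H}$ to the connected component containing $1$ of the graph with vertex set $G$ and edge set $E(\mathbb{H})\cup F$. The measure $\mu$ is insertion-tolerant if $\mu(i_F(B))>0$ for every finite symmetric $F\subset E$ and every Borel set $B$ with $\mu(B)>0$. Minimality and repetitiveness: a closed subset $Z\subset\mathcal{G}$ is $\mathcal{R}$-minimal if for every $\mathbb{K}\in Z$ the class $\mathcal{R}[\mathbb{K}]$ is contained in $Z$ and dense in $Z$. A subgraph $\mathbb{H}\in\mathcal{G}$ is repetitive if its orbit closure $\overline{\mathcal{R}[\mathbb{H}]}$ is $\mathcal{R}$-minimal. *)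

theory Defs
  imports
    "HOL-Algebra.Generated_Groups"
    "HOL-Probability.Probability"
    "Graph_Theory.Digraph_Component"
begin

text \<open>
  Undirected graphs are symmetric digraphs without parallel arcs; loops are allowed, since a
  symmetric generating set may contain the identity.
\<close>

definition cayley_graph :: "('a, 'm) monoid_scheme \<Rightarrow> 'a set \<Rightarrow> 'a pair_pre_digraph" where
  "cayley_graph G S =
     \<lparr> pverts = carrier G,
       parcs = {(g, h). g \<in> carrier G \<and> h \<in> carrier G \<and> h \<otimes>\<^bsub>G\<^esub> inv\<^bsub>G\<^esub> g \<in> S} \<rparr>"

definition subgraph_space :: "('a, 'm) monoid_scheme \<Rightarrow> 'a set \<Rightarrow> 'a pair_pre_digraph set" where
  "subgraph_space G S =
     {H. subgraph (with_proj H) (with_proj (cayley_graph G S)) \<and> symmetric (with_proj H)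
       \<and> Digraph_Component.connected (with_proj H) \<and> \<one>\<^bsub>G\<^esub> \<in> pverts H}"

definition pair_induce :: "'a pair_pre_digraph \<Rightarrow> 'a set \<Rightarrow> 'a pair_pre_digraph" where
  "pair_induce H W = \<lparr> pverts = W, parcs = {e \<in> parcs H. fst e \<in> W \<and> snd e \<in> W} \<rparr>"

lemma with_proj_pair_induce: "with_proj (pair_induce H W) = with_proj H \<restriction> W"
  by (simp add: pair_induce_def with_proj_def induce_subgraph_def)


subsection \<open>The Gromov-Hausdorff metric and its Borel sets\<close>

text \<open>
  A vertex is at combinatorial distance at most \<open>r\<close> from \<open>u\<close> iff it is joined to \<open>u\<close> by a
  walk with at most \<open>r\<close> edges. The ball is the subgraph induced on these vertices.
\<close>

definition gball :: "'a pair_pre_digraph \<Rightarrow> 'a \<Rightarrow> real \<Rightarrow> 'a pair_pre_digraph" where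
  "gball H u r = pair_induce H {v. \<exists>n. real n \<le> r \<and> (u, v) \<in> parcs H ^^ n}"

text \<open>
  The supremum is taken in \<open>[0, \<infinity>]\<close>. It is over the empty set, hence \<open>0\<close>, when already the balls
  of radius \<open>0\<close> differ, which can happen only through a loop at \<open>u\<close>.
\<close>

definition agreement :: "'a \<Rightarrow> 'a pair_pre_digraph \<Rightarrow> 'a pair_pre_digraph \<Rightarrow> ennreal" where
  "agreement u H H' = Sup (ennreal ` {r. 0 \<le> r \<and> gball H u r = gball H' u r})"

definition gh_dist :: "'a \<Rightarrow> 'a pair_pre_digraph \<Rightarrow> 'a pair_pre_digraph \<Rightarrow> real" where
  "gh_dist u H H' =
     (if agreement u H H' = \<infinity> then 0 else 1 / exp (enn2real (agreement u H H')))"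

definition gh_topology ::
    "('a, 'm) monoid_scheme \<Rightarrow> 'a set \<Rightarrow> 'a pair_pre_digraph topology" where
  "gh_topology G S = Metric_space.mtopology (subgraph_space G S) (gh_dist \<one>\<^bsub>G\<^esub>)"

definition gh_borel :: "('a, 'm) monoid_scheme \<Rightarrow> 'a set \<Rightarrow> 'a pair_pre_digraph measure" where
  "gh_borel G S = sigma (subgraph_space G S) {U. openin (gh_topology G S) U}"

definition borel_prob ::
    "('a, 'm) monoid_scheme \<Rightarrow> 'a set \<Rightarrow> 'a pair_pre_digraph measure \<Rightarrow> bool" where
  "borel_prob G S \<mu> \<longleftrightarrow> prob_space \<mu> \<and> sets \<mu> = sets (gh_borel G S)"


subsection \<open>The equivalence relation\<close>

text \<open>The action \<open>g.H = H g\<^sup>-\<^sup>1\<close>.\<close>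

definition translate ::
    "('a, 'm) monoid_scheme \<Rightarrow> 'a \<Rightarrow> 'a pair_pre_digraph \<Rightarrow> 'a pair_pre_digraph" where
  "translate G g H =
     \<lparr> pverts = (\<lambda>x. x \<otimes>\<^bsub>G\<^esub> inv\<^bsub>G\<^esub> g) ` pverts H,
       parcs = (\<lambda>(x, y). (x \<otimes>\<^bsub>G\<^esub> inv\<^bsub>G\<^esub> g, y \<otimes>\<^bsub>G\<^esub> inv\<^bsub>G\<^esub> g)) ` parcs H \<rparr>"

text \<open>Classes \<open>\<R>[H]\<close> and saturations \<open>\<R>[B]\<close> are the relational images
  \<open>orbit_rel G S `` {H}\<close> and \<open>orbit_rel G S `` B\<close>.\<close>

definition orbit_rel :: "('a, 'm) monoid_scheme \<Rightarrow> 'a set \<Rightarrow> 'a pair_pre_digraph rel" where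
  "orbit_rel G S =
     {(H, H'). H \<in> subgraph_space G S \<and> H' \<in> subgraph_space G S
       \<and> (\<exists>g \<in> carrier G. H' = translate G g H)}"

definition infinite_states ::
    "('a, 'm) monoid_scheme \<Rightarrow> 'a set \<Rightarrow> 'a pair_pre_digraph set" where
  "infinite_states G S = {H \<in> subgraph_space G S. infinite (orbit_rel G S `` {H})}"

definition orbit_closure ::
    "('a, 'm) monoid_scheme \<Rightarrow> 'a set \<Rightarrow> 'a pair_pre_digraph \<Rightarrow> 'a pair_pre_digraph set" where
  "orbit_closure G S H = gh_topology G S closure_of (orbit_rel G S `` {H})"

definition minimal_set ::
    "('a, 'm) monoid_scheme \<Rightarrow> 'a set \<Rightarrow> 'a pair_pre_digraph set \<Rightarrow> bool" where
  "minimal_set G S Z \<longleftrightarrow> closedin (gh_topology G S) Z \<and>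
     (\<forall>K \<in> Z. orbit_rel G S `` {K} \<subseteq> Z \<and>
        Z \<subseteq> gh_topology G S closure_of (orbit_rel G S `` {K}))"

definition repetitive ::
    "('a, 'm) monoid_scheme \<Rightarrow> 'a set \<Rightarrow> 'a pair_pre_digraph \<Rightarrow> bool" where
  "repetitive G S H \<longleftrightarrow> H \<in> subgraph_space G S \<and> minimal_set G S (orbit_closure G S H)"


subsection \<open>Properties of measures\<close>

text \<open>
  The measure of a non-measurable set is \<open>0\<close> by convention, but all the sets measured below are
  Borel: the images \<open>\<phi> ` A'\<close> by the Lusin-Souslin theorem, the saturations \<open>orbit_rel G S `` B\<close>
  since they are countable unions of translates of Borel sets, and the images of Borel sets under
  \<open>insertion\<close> since the space is a finite union of clopen sets on which this continuous map is
  injective.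
\<close>

definition partial_transformation ::
    "('a, 'm) monoid_scheme \<Rightarrow> 'a set \<Rightarrow> 'a pair_pre_digraph set \<Rightarrow> 'a pair_pre_digraph set
      \<Rightarrow> ('a pair_pre_digraph \<Rightarrow> 'a pair_pre_digraph) \<Rightarrow> bool" where
  "partial_transformation G S A B \<phi> \<longleftrightarrow>
     A \<in> sets (gh_borel G S) \<and> B \<in> sets (gh_borel G S) \<and> bij_betw \<phi> A B
     \<and> \<phi> \<in> restrict_space (gh_borel G S) A \<rightarrow>\<^sub>M restrict_space (gh_borel G S) B
     \<and> (\<forall>H \<in> A. (H, \<phi> H) \<in> orbit_rel G S)"

definition quasi_invariant ::
    "('a, 'm) monoid_scheme \<Rightarrow> 'a set \<Rightarrow> 'a pair_pre_digraph measure \<Rightarrow> bool" where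
  "quasi_invariant G S \<mu> \<longleftrightarrow>
     (\<forall>A B \<phi>. partial_transformation G S A B \<phi> \<longrightarrow>
        (\<forall>A' \<in> sets (gh_borel G S). A' \<subseteq> A \<longrightarrow>
           (emeasure \<mu> A' = 0 \<longleftrightarrow> emeasure \<mu> (\<phi> ` A') = 0)))"

definition ergodic ::
    "('a, 'm) monoid_scheme \<Rightarrow> 'a set \<Rightarrow> 'a pair_pre_digraph measure \<Rightarrow> bool" where
  "ergodic G S \<nu> \<longleftrightarrow> (\<forall>B \<in> sets (gh_borel G S). emeasure \<nu> (orbit_rel G S `` B) \<in> {0, 1})"

text \<open>For symmetric \<open>F\<close> the vertices reachable from \<open>\<one>\<close> form its connected component.\<close>

definition insertion ::
    "('a, 'm) monoid_scheme \<Rightarrow> 'a rel \<Rightarrow> 'a pair_pre_digraph \<Rightarrow> 'a pair_pre_digraph" where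
  "insertion G F H =
     (let X = \<lparr> pverts = carrier G, parcs = parcs H \<union> F \<rparr>
      in pair_induce X {v. \<one>\<^bsub>G\<^esub> \<rightarrow>\<^sup>*\<^bsub>with_proj X\<^esub> v})"

definition insertion_tolerant ::
    "('a, 'm) monoid_scheme \<Rightarrow> 'a set \<Rightarrow> 'a pair_pre_digraph measure \<Rightarrow> bool" where
  "insertion_tolerant G S \<mu> \<longleftrightarrow>
     (\<forall>F. finite F \<and> sym F \<and> F \<subseteq> parcs (cayley_graph G S) \<longrightarrow>
        (\<forall>B \<in> sets (gh_borel G S). emeasure \<mu> B > 0 \<longrightarrow> emeasure \<mu> (insertion G F ` B) > 0))"

definition mutually_singular :: "'b measure \<Rightarrow> 'b measure \<Rightarrow> bool" where
  "mutually_singular \<mu> \<nu> \<longleftrightarrow>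
     (\<exists>A \<in> sets \<mu> \<inter> sets \<nu>. emeasure \<mu> A = 0 \<and> emeasure \<nu> (space \<nu> - A) = 0)"


subsection \<open>The Gromov-Hausdorff distance is a metric\<close>

lemma gball_gball:
  assumes "r \<le> s"
  shows "gball (gball H u s) u r = gball H u r"
proof -
  let ?B = "{v. \<exists>n. real n \<le> s \<and> (u, v) \<in> parcs H ^^ n}"
  let ?E = "parcs (gball H u s)"
  have E: "?E = {e \<in> parcs H. fst e \<in> ?B \<and> snd e \<in> ?B}"
    by (simp add: gball_def pair_induce_def)
  have up: "(u, v) \<in> ?E ^^ n" if "(u, v) \<in> parcs H ^^ n" "real n \<le> s" for n v
    using that
  proof (induction n arbitrary: v)
    case (Suc n)
    then obtain w where w: "(u, w) \<in> parcs H ^^ n" "(w, v) \<in> parcs H" by auto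
    have "w \<in> ?B" using w(1) Suc.prems(2) by (intro CollectI exI[of _ n]) auto
    moreover have "v \<in> ?B" using Suc.prems by blast
    ultimately have "(w, v) \<in> ?E" using w(2) E by simp
    moreover have "(u, w) \<in> ?E ^^ n" using Suc.IH w(1) Suc.prems(2) by simp
    ultimately show ?case by auto
  qed simp
  have down: "(u, v) \<in> parcs H ^^ n" if "(u, v) \<in> ?E ^^ n" for n v
    using that by (induction n arbitrary: v) (auto simp: E)
  have *: "{v. \<exists>n. real n \<le> r \<and> (u, v) \<in> ?E ^^ n} = {v. \<exists>n. real n \<le> r \<and> (u, v) \<in> parcs H ^^ n}"
    using up down assms by (meson order_trans)
  have **: "v \<in> ?B" if "\<exists>n. real n \<le> r \<and> (u, v) \<in> parcs H ^^ n" for v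
    using that assms order_trans by blast
  show ?thesis
    unfolding gball_def[of "gball H u s"] * unfolding gball_def[of H u r] pair_induce_def E
    using ** by auto
qed

lemma gball_eq_mono: "gball H u s = gball H' u s \<Longrightarrow> r \<le> s \<Longrightarrow> gball H u r = gball H' u r"
  by (metis gball_gball)

lemma gball_eq_if_less_agreement:
  assumes "ennreal r < agreement u H H'"
  shows "gball H u r = gball H' u r"
proof -
  obtain s where "0 \<le> s" "gball H u s = gball H' u s" "ennreal r < ennreal s"
    using assms by (auto simp: agreement_def less_Sup_iff)
  thus ?thesis using gball_eq_mono by (metis ennreal_leI not_less nle_le)
qed

lemma agreement_ultra: "min (agreement u H K) (agreement u K L) \<le> agreement u H L"
proof (rule dense_le)
  fix x assume x: "x < min (agreement u H K) (agreement u K L)"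
  then have "x \<noteq> \<infinity>" by auto
  then obtain r where r: "x = ennreal r" "0 \<le> r" by (cases x) auto
  then have "gball H u r = gball L u r"
    using x gball_eq_if_less_agreement by (metis min_less_iff_conj)
  then show "x \<le> agreement u H L"
    unfolding agreement_def r(1) using r(2) by (intro Sup_upper) auto
qed

lemma gh_dist_le_iff: "gh_dist u H H' \<le> gh_dist u K K' \<longleftrightarrow> agreement u K K' \<le> agreement u H H'"
proof (cases "agreement u H H' = \<infinity> \<or> agreement u K K' = \<infinity>")
  case True
  then show ?thesis
    by (auto simp: gh_dist_def not_le top.extremum_unique)
next
  case False
  then obtain a b where "agreement u H H' = ennreal a" "0 \<le> a" "agreement u K K' = ennreal b" "0 \<le> b"
    by (metis ennreal_cases infinity_ennreal_def)
  then show ?thesis by (simp add: gh_dist_def field_simps)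
qed

lemma gh_dist_nonneg: "0 \<le> gh_dist u H H'"
  by (simp add: gh_dist_def)

lemma gh_dist_ultra: "gh_dist u H L \<le> max (gh_dist u H K) (gh_dist u K L)"
  using agreement_ultra[of u H K L] by (auto simp: le_max_iff_disj gh_dist_le_iff min_le_iff_disj)

lemma subgraph_space_vertex:
  assumes "H \<in> subgraph_space G S" "v \<in> pverts H"
  shows "\<exists>n. (\<one>\<^bsub>G\<^esub>, v) \<in> parcs H ^^ n"
proof -
  have "sym (parcs H)" and con: "Digraph_Component.connected (with_proj H)" "\<one>\<^bsub>G\<^esub> \<in> pverts H"
    using assms by (auto simp: subgraph_space_def symmetric_def)
  then have par: "parcs (mk_symmetric (with_proj H)) = parcs H"
    by (auto simp: mk_symmetric_def sym_def)
  have "pverts (mk_symmetric (with_proj H)) = pverts H"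
    by (simp add: mk_symmetric_def)
  then have "\<one>\<^bsub>G\<^esub> \<rightarrow>\<^sup>*\<^bsub>with_proj (mk_symmetric (with_proj H))\<^esub> v"
    using con assms(2) by (simp add: Digraph_Component.connected_def strongly_connected_def)
  from reachable_rtranclI[OF this] have "(\<one>\<^bsub>G\<^esub>, v) \<in> (parcs H)\<^sup>*"
    by (simp add: par)
  then show ?thesis by (simp add: rtrancl_power)
qed

lemma subgraph_space_arc:
  assumes "H \<in> subgraph_space G S" "e \<in> parcs H"
  shows "fst e \<in> pverts H" "snd e \<in> pverts H"
  using assms wf_digraph.tail_in_verts[of "with_proj H" e] wf_digraph.head_in_verts[of "with_proj H" e]
  by (simp_all add: subgraph_space_def subgraph_def)

lemma walk_in_verts:
  assumes "H \<in> subgraph_space G S" "(\<one>\<^bsub>G\<^esub>, v) \<in> parcs H ^^ n"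
  shows "v \<in> pverts H"
proof (cases n)
  case 0 with assms show ?thesis by (simp add: subgraph_space_def)
next
  case (Suc m) with assms show ?thesis by (auto dest: subgraph_space_arc)
qed

lemma gballs_determine_le:
  assumes H: "H \<in> subgraph_space G S" and K: "K \<in> subgraph_space G S"
    and eq: "\<And>r. gball H \<one>\<^bsub>G\<^esub> r = gball K \<one>\<^bsub>G\<^esub> r"
  shows "pverts H \<subseteq> pverts K \<and> parcs H \<subseteq> parcs K"
proof (intro conjI subsetI)
  fix v assume "v \<in> pverts H"
  then obtain n where "(\<one>\<^bsub>G\<^esub>, v) \<in> parcs H ^^ n" using subgraph_space_vertex[OF H] by blast
  then have "v \<in> pverts (gball H \<one>\<^bsub>G\<^esub> (real n))" by (auto simp: gball_def pair_induce_def)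
  then show "v \<in> pverts K" unfolding eq using walk_in_verts[OF K] by (auto simp: gball_def pair_induce_def)
next
  fix e assume e: "e \<in> parcs H"
  obtain n m where "(\<one>\<^bsub>G\<^esub>, fst e) \<in> parcs H ^^ n" "(\<one>\<^bsub>G\<^esub>, snd e) \<in> parcs H ^^ m"
    using subgraph_space_vertex[OF H] subgraph_space_arc[OF H e] by blast
  then have "e \<in> parcs (gball H \<one>\<^bsub>G\<^esub> (real (max n m)))"
    using e unfolding gball_def pair_induce_def
    by (simp, meson max.cobounded1 max.cobounded2)
  then show "e \<in> parcs K" unfolding eq by (auto simp: gball_def pair_induce_def)
qed

lemma gh_dist_eq_0_iff:
  assumes "H \<in> subgraph_space G S" "K \<in> subgraph_space G S"
  shows "gh_dist \<one>\<^bsub>G\<^esub> H K = 0 \<longleftrightarrow> H = K"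
proof
  assume "gh_dist \<one>\<^bsub>G\<^esub> H K = 0"
  then have "agreement \<one>\<^bsub>G\<^esub> H K = \<infinity>" by (simp add: gh_dist_def split: if_splits)
  then have "gball H \<one>\<^bsub>G\<^esub> r = gball K \<one>\<^bsub>G\<^esub> r" for r
    by (intro gball_eq_if_less_agreement) auto
  then show "H = K"
    using gballs_determine_le[of H G S K] gballs_determine_le[of K G S H] assms
    by (metis subset_antisym pair_pre_digraph.equality unit.exhaust)
next
  assume "H = K"
  have "ennreal (real n) \<le> agreement \<one>\<^bsub>G\<^esub> H H" for n
    unfolding agreement_def by (intro Sup_upper) auto
  then have "agreement \<one>\<^bsub>G\<^esub> H H = \<infinity>"
    by (metis ennreal_of_nat_eq_real_of_nat infinity_ennreal_def ennreal_Ex_less_of_nat not_less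
        top.not_eq_extremum)
  with \<open>H = K\<close> show "gh_dist \<one>\<^bsub>G\<^esub> H K = 0" by (simp add: gh_dist_def)
qed

lemma Metric_space_subgraph_space: "Metric_space (subgraph_space G S) (gh_dist \<one>\<^bsub>G\<^esub>)"
proof
  fix H K L
  show "0 \<le> gh_dist \<one>\<^bsub>G\<^esub> H K" by (rule gh_dist_nonneg)
  show "gh_dist \<one>\<^bsub>G\<^esub> H K = gh_dist \<one>\<^bsub>G\<^esub> K H"
    by (simp add: gh_dist_def agreement_def eq_commute)
  show "gh_dist \<one>\<^bsub>G\<^esub> H L \<le> gh_dist \<one>\<^bsub>G\<^esub> H K + gh_dist \<one>\<^bsub>G\<^esub> K L"
    using gh_dist_ultra[of "\<one>\<^bsub>G\<^esub>" H L K] gh_dist_nonneg[of "\<one>\<^bsub>G\<^esub>" H K]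
      gh_dist_nonneg[of "\<one>\<^bsub>G\<^esub>" K L] by linarith
qed (rule gh_dist_eq_0_iff)

end

theory Submission
  imports Defs
begin

text \<open>
  Write \<open>\<Gamma>\<close> for the Cayley graph and \<open>Z\<close> for the orbit closure of \<open>H\<close>. The orbit of \<open>\<Gamma>\<close> is a
  single point, so a minimal set containing \<open>\<Gamma>\<close> is \<open>{\<Gamma>}\<close>; since \<open>H\<close> is proper, \<open>\<Gamma> \<notin> Z\<close>
  (\<open>cayley_notin_proper_minimal_set\<close>). As \<open>Z\<close> is closed, some ball of \<open>\<Gamma>\<close> around \<open>\<one>\<close> is contained
  in no member of \<open>Z\<close> (\<open>closed_set_avoids_ball\<close>). Let \<open>F\<close> be its finite set of arcs. By invariance
  of \<open>Z\<close>, no right translate \<open>Fg\<close> with \<open>g\<close> a vertex of \<open>K \<in> Z\<close> is contained in \<open>K\<close> either.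

  Inserting \<open>F\<close> therefore throws every member of \<open>Z\<close> out of \<open>Z\<close>. If \<open>\<mu>\<^sub>\<infinity>(Z)\<close> were positive,
  ergodicity would make it \<open>1\<close>, so that \<open>\<G>\<^sub>\<infinity> - Z\<close> would be a null set; insertion tolerance makes
  the image of \<open>\<G>\<^sub>\<infinity> \<inter> Z\<close> under insertion a set of positive measure outside \<open>Z\<close>. This is a
  contradiction provided that the image stays inside \<open>\<G>\<^sub>\<infinity>\<close>, where ergodicity controls the measure.

  That insertion does not make the orbit finite (\<open>infinite_orbit_insertion\<close>) is the crux, and it fails
  for general \<open>K\<close>: if \<open>K\<close> is an infinite \<open>\<Gamma>\<close> with one edge deleted and still connected, then
  restoring that edge gives \<open>\<Gamma>\<close>, whose orbit is a point.
  For \<open>K \<in> Z\<close> it holds because an infinite graph \<open>L\<close> with finite orbit is periodic: the copy of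
  \<open>F\<close> inserted at \<open>\<one>\<close> recurs as \<open>Fg \<subseteq> L\<close> for infinitely many \<open>g\<close>
  (\<open>recurring_pattern_if_finite_orbit\<close>). Only finitely many of these meet \<open>F\<close>, so one of them consists
  of arcs that were already present in \<open>K\<close>, which is impossible in \<open>Z\<close>.
\<close>

section \<open>Subgraphs of a Cayley graph as sets of walks\<close>

lemma reachable_with_proj_iff:
  assumes "parcs X \<subseteq> pverts X \<times> pverts X" "u \<in> pverts X"
  shows "u \<rightarrow>\<^sup>*\<^bsub>with_proj X\<^esub> v \<longleftrightarrow> (u, v) \<in> (parcs X)\<^sup>*"
proof
  assume "u \<rightarrow>\<^sup>*\<^bsub>with_proj X\<^esub> v"
  from reachable_rtranclI[OF this] show "(u, v) \<in> (parcs X)\<^sup>*" by simp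
next
  interpret wf_digraph "with_proj X"
    by unfold_locales (use assms in auto)
  assume "(u, v) \<in> (parcs X)\<^sup>*"
  then show "u \<rightarrow>\<^sup>*\<^bsub>with_proj X\<^esub> v"
  proof (induction rule: rtrancl_induct)
    case base
    show ?case using assms(2) by (simp add: reachable_refl)
  next
    case (step y z)
    then show ?case using reachable_adj_trans[of u y z] by simp
  qed
qed

lemma (in group) cayley_arc_iff:
  "(g, h) \<in> parcs (cayley_graph G S) \<longleftrightarrow> g \<in> carrier G \<and> h \<in> carrier G \<and> h \<otimes> inv g \<in> S"
  by (simp add: cayley_graph_def)

lemma (in group) right_translate_quotient:
  assumes "a \<in> carrier G" "b \<in> carrier G" "g \<in> carrier G"
  shows "(b \<otimes> g) \<otimes> inv (a \<otimes> g) = b \<otimes> inv a"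
proof -
  have "g \<otimes> (inv g \<otimes> inv a) = inv a" using assms by (simp add: m_assoc[symmetric])
  then show ?thesis using assms by (simp add: inv_mult_group m_assoc)
qed

text \<open>
  Connectedness of a digraph is strong connectedness of its symmetrisation. Since the arc sets here are
  symmetric and \<open>\<one>\<close> is a vertex, it means that every vertex is reached from \<open>\<one>\<close>. In this form it can
  be checked for translates and insertions by manipulating relations only.
\<close>

lemma (in group) subgraph_space_iff:
  "H \<in> subgraph_space G S \<longleftrightarrow>
     pverts H \<subseteq> carrier G \<and> parcs H \<subseteq> parcs (cayley_graph G S) \<and> sym (parcs H) \<and> \<one> \<in> pverts H
     \<and> parcs H \<subseteq> pverts H \<times> pverts H \<and> (\<forall>v \<in> pverts H. (\<one>, v) \<in> (parcs H)\<^sup>*)"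
  (is "_ \<longleftrightarrow> ?R")
proof
  assume H: "H \<in> subgraph_space G S"
  then have "pverts H \<subseteq> carrier G" "parcs H \<subseteq> parcs (cayley_graph G S)" "sym (parcs H)" "\<one> \<in> pverts H"
    by (simp_all add: subgraph_space_def subgraph_def symmetric_def cayley_graph_def)
  moreover have "parcs H \<subseteq> pverts H \<times> pverts H"
    using subgraph_space_arc[OF H] by force
  moreover have "\<forall>v \<in> pverts H. (\<one>, v) \<in> (parcs H)\<^sup>*"
    using subgraph_space_vertex[OF H] by (auto simp: rtrancl_power)
  ultimately show ?R by blast
next
  assume H: ?R
  have par: "parcs (mk_symmetric (with_proj H)) = parcs H"
    using H by (auto simp: mk_symmetric_def sym_def)
  have ver: "pverts (mk_symmetric (with_proj H)) = pverts H"
    by (simp add: mk_symmetric_def)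
  have "strongly_connected (with_proj (mk_symmetric (with_proj H)))"
  proof (rule strongly_connectedI)
    show "verts (with_proj (mk_symmetric (with_proj H))) \<noteq> {}"
      using H by (auto simp: ver)
  next
    fix u v assume uv: "u \<in> verts (with_proj (mk_symmetric (with_proj H)))"
      "v \<in> verts (with_proj (mk_symmetric (with_proj H)))"
    then have "(\<one>, u) \<in> (parcs H)\<^sup>*" "(\<one>, v) \<in> (parcs H)\<^sup>*"
      using H by (simp_all add: ver)
    then have "(u, v) \<in> (parcs H)\<^sup>*"
      using H by (meson rtrancl_trans sym_rtrancl symD)
    then show "u \<rightarrow>\<^sup>*\<^bsub>with_proj (mk_symmetric (with_proj H))\<^esub> v"
      using uv H by (subst reachable_with_proj_iff) (auto simp: par ver)
  qed
  moreover have "wf_digraph (with_proj H)" "wf_digraph (with_proj (cayley_graph G S))"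
    using H by (auto simp: wf_digraph_def cayley_graph_def)
  ultimately show "H \<in> subgraph_space G S"
    using H by (simp add: subgraph_space_def subgraph_def symmetric_def compatible_def
        Digraph_Component.connected_def cayley_graph_def)
qed

lemma (in group) sym_cayley:
  assumes "\<And>s. s \<in> S \<Longrightarrow> inv s \<in> S"
  shows "sym (parcs (cayley_graph G S))"
proof (rule symI)
  fix g h assume "(g, h) \<in> parcs (cayley_graph G S)"
  then have *: "g \<in> carrier G" "h \<in> carrier G" "h \<otimes> inv g \<in> S" by (auto simp: cayley_arc_iff)
  from * have "inv (h \<otimes> inv g) = g \<otimes> inv h" by (simp add: inv_mult_group)
  with * assms[OF *(3)] show "(h, g) \<in> parcs (cayley_graph G S)" by (simp add: cayley_arc_iff)
qed

lemma (in group) cayley_mem_subgraph_space: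
  assumes "S \<subseteq> carrier G" "\<And>s. s \<in> S \<Longrightarrow> inv s \<in> S" "generate G S = carrier G"
  shows "cayley_graph G S \<in> subgraph_space G S"
proof -
  let ?E = "parcs (cayley_graph G S)"
  have arc: "(g, s \<otimes> g) \<in> ?E" if "s \<in> S" "g \<in> carrier G" for s g
    using that assms(1) by (auto simp: cayley_arc_iff m_assoc)
  \<comment> \<open>The start \<open>g\<close> is arbitrary so that walks for two factors can be concatenated.\<close>
  have "x \<in> carrier G \<and> (\<forall>g \<in> carrier G. (g, x \<otimes> g) \<in> ?E\<^sup>*)" if "x \<in> generate G S" for x
    using that
  proof (induction rule: generate.induct)
    case one
    show ?case by auto
  next
    case (incl h)
    then show ?case using arc assms(1) by auto
  next
    case (inv h)
    then show ?case using arc assms(1,2) by auto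
  next
    case (eng x y)
    have "(g, (x \<otimes> y) \<otimes> g) \<in> ?E\<^sup>*" if g: "g \<in> carrier G" for g
    proof -
      have "(g, y \<otimes> g) \<in> ?E\<^sup>*" "(y \<otimes> g, x \<otimes> (y \<otimes> g)) \<in> ?E\<^sup>*"
        using eng.IH g by auto
      then have "(g, x \<otimes> (y \<otimes> g)) \<in> ?E\<^sup>*" by (rule rtrancl_trans)
      then show ?thesis using eng.IH g by (simp add: m_assoc)
    qed
    with eng.IH show ?case by auto
  qed
  then have "(\<one>, x) \<in> ?E\<^sup>*" if "x \<in> carrier G" for x
    using that assms(3) by (metis one_closed r_one)
  then show ?thesis
    unfolding subgraph_space_iff using sym_cayley[OF assms(2)]
    by (auto simp: cayley_graph_def)
qed

section \<open>Balls\<close>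

lemma relpow_mono_set: "R \<subseteq> T \<Longrightarrow> R ^^ n \<subseteq> T ^^ n" for R T :: "'a rel"
  by (induction n) auto

text \<open>
  All vertices of a walk of length at most \<open>r\<close> from \<open>u\<close> lie in the ball of radius \<open>r\<close>. Hence the arcs
  of a ball alone already connect it to its centre, and a graph that contains these arcs has at least
  that ball.
\<close>

lemma relpow_gball:
  assumes "(u, v) \<in> parcs H ^^ n" "real n \<le> r"
  shows "(u, v) \<in> parcs (gball H u r) ^^ n"
  using assms
proof (induction n arbitrary: v)
  case (Suc n)
  then obtain w where w: "(u, w) \<in> parcs H ^^ n" "(w, v) \<in> parcs H" by auto
  have "\<exists>k. real k \<le> r \<and> (u, w) \<in> parcs H ^^ k" using w(1) Suc.prems(2) by (intro exI[of _ n]) auto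
  moreover have "\<exists>k. real k \<le> r \<and> (u, v) \<in> parcs H ^^ k" using Suc.prems by blast
  ultimately have "(w, v) \<in> parcs (gball H u r)" using w(2) by (simp add: gball_def pair_induce_def)
  moreover have "(u, w) \<in> parcs (gball H u r) ^^ n" using Suc.IH w(1) Suc.prems(2) by simp
  ultimately show ?case by auto
qed simp

lemma gball_arc_reachable:
  assumes "e \<in> parcs (gball H u r)"
  shows "(u, fst e) \<in> (parcs (gball H u r))\<^sup>*"
proof -
  obtain n where "real n \<le> r" "(u, fst e) \<in> parcs H ^^ n"
    using assms by (auto simp: gball_def pair_induce_def)
  then show ?thesis using relpow_gball rtrancl_power by metis
qed

lemma gball_eq_if_sandwiched:
  assumes "parcs (gball H u r) \<subseteq> parcs K" "parcs K \<subseteq> parcs H"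
  shows "gball K u r = gball H u r"
proof -
  have "(u, v) \<in> parcs K ^^ n \<longleftrightarrow> (u, v) \<in> parcs H ^^ n" if "real n \<le> r" for n v
    using that relpow_gball[of u v n H r] relpow_mono_set[OF assms(1), of n]
      relpow_mono_set[OF assms(2), of n] by blast
  then have eq: "{v. \<exists>n. real n \<le> r \<and> (u, v) \<in> parcs K ^^ n} = {v. \<exists>n. real n \<le> r \<and> (u, v) \<in> parcs H ^^ n}"
    by blast
  show ?thesis
    unfolding gball_def eq using assms by (auto simp: gball_def pair_induce_def)
qed

lemma sym_gball: "sym (parcs H) \<Longrightarrow> sym (parcs (gball H u r))"
  by (auto simp: gball_def pair_induce_def sym_def)

lemma (in group) finite_cayley_ball:
  assumes "finite S"
  shows "finite (parcs (gball (cayley_graph G S) u (real n)))"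
proof -
  let ?E = "parcs (cayley_graph G S)"
  have "?E `` {g} \<subseteq> (\<lambda>s. s \<otimes> g) ` S" for g
  proof
    fix h assume "h \<in> ?E `` {g}"
    then have "g \<in> carrier G" "h \<in> carrier G" "h \<otimes> inv g \<in> S" by (auto simp: cayley_arc_iff)
    moreover from this have "h = (h \<otimes> inv g) \<otimes> g" by (simp add: m_assoc)
    ultimately show "h \<in> (\<lambda>s. s \<otimes> g) ` S" by blast
  qed
  then have out: "finite (?E `` {g})" for g
    using assms by (meson finite_imageI finite_subset)
  have pow: "finite ((?E ^^ k) `` {u})" for k
  proof (induction k)
    case (Suc k)
    have "(?E ^^ Suc k) `` {u} = (\<Union>g \<in> (?E ^^ k) `` {u}. ?E `` {g})" by auto
    then show ?case using Suc out by simp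
  qed simp
  let ?B = "\<Union>k \<in> {..n}. (?E ^^ k) `` {u}"
  have "parcs (gball (cayley_graph G S) u (real n)) \<subseteq> ?B \<times> ?B"
    by (auto simp: gball_def pair_induce_def)
  moreover have "finite (?B \<times> ?B)" using pow by blast
  ultimately show ?thesis by (rule finite_subset)
qed

lemma gh_dist_le_if_gball_eq:
  assumes "gball H u r = gball K u r" "0 \<le> r"
  shows "gh_dist u H K \<le> exp (- r)"
proof (cases "agreement u H K = \<infinity>")
  case False
  have "ennreal r \<le> agreement u H K"
    unfolding agreement_def using assms by (intro Sup_upper) auto
  then have "r \<le> enn2real (agreement u H K)"
    using False by (metis assms(2) enn2real_ennreal enn2real_mono infinity_ennreal_def top.not_eq_extremum)
  then show ?thesis using False by (simp add: gh_dist_def exp_minus field_simps)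
qed (simp add: gh_dist_def)

text \<open>
  A subgraph of \<open>\<Gamma>\<close> containing the arcs of the \<open>n\<close>-ball of \<open>\<Gamma>\<close> has the same \<open>n\<close>-ball as \<open>\<Gamma>\<close> and so
  is within distance \<open>exp (- n)\<close> of it, whereas \<open>\<Gamma>\<close> has positive distance from a closed set that
  misses it.
\<close>

lemma (in group) closed_set_avoids_ball:
  assumes "closedin (gh_topology G S) Z"
    and "cayley_graph G S \<in> subgraph_space G S" "cayley_graph G S \<notin> Z"
  obtains n :: nat where
    "\<And>K. K \<in> Z \<Longrightarrow> \<not> parcs (gball (cayley_graph G S) \<one> (real n)) \<subseteq> parcs K"
proof -
  interpret M: Metric_space "subgraph_space G S" "gh_dist \<one>" by (rule Metric_space_subgraph_space)
  have "openin M.mtopology (subgraph_space G S - Z)" and Z: "Z \<subseteq> subgraph_space G S"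
    using assms(1) by (auto simp: gh_topology_def closedin_def)
  then obtain e where e: "e > 0" "M.mball (cayley_graph G S) e \<subseteq> subgraph_space G S - Z"
    using assms(2,3) M.openin_mtopology by (metis DiffI)
  obtain n :: nat where n: "- ln e < real n" using reals_Archimedean2 by blast
  then have "- real n < ln e" by simp
  then have exp: "exp (- real n) < e" using e(1) by (metis exp_less_mono exp_ln)
  show ?thesis
  proof
    fix K assume K: "K \<in> Z"
    show "\<not> parcs (gball (cayley_graph G S) \<one> (real n)) \<subseteq> parcs K"
    proof
      assume "parcs (gball (cayley_graph G S) \<one> (real n)) \<subseteq> parcs K"
      moreover have "parcs K \<subseteq> parcs (cayley_graph G S)"
        using subsetD[OF Z K] by (simp add: subgraph_space_iff)
      ultimately have "gball (cayley_graph G S) \<one> (real n) = gball K \<one> (real n)"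
        using gball_eq_if_sandwiched by metis
      from gh_dist_le_if_gball_eq[OF this] exp have "gh_dist \<one> (cayley_graph G S) K < e" by simp
      with K Z assms(2) have "K \<in> M.mball (cayley_graph G S) e" by (auto simp: M.in_mball)
      with e(2) K show False by blast
    qed
  qed
qed

section \<open>Translates and orbits\<close>

lemma (in group) translate_arc_iff:
  assumes "g \<in> carrier G" "parcs K \<subseteq> carrier G \<times> carrier G" "a \<in> carrier G" "b \<in> carrier G"
  shows "(a, b) \<in> parcs (translate G g K) \<longleftrightarrow> (a \<otimes> g, b \<otimes> g) \<in> parcs K"
proof
  assume "(a, b) \<in> parcs (translate G g K)"
  then obtain x y where xy: "(x, y) \<in> parcs K" "a = x \<otimes> inv g" "b = y \<otimes> inv g"
    by (auto simp: translate_def)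
  then have "x \<in> carrier G" "y \<in> carrier G" using assms(2) by auto
  with xy assms(1) show "(a \<otimes> g, b \<otimes> g) \<in> parcs K" by (simp add: m_assoc)
next
  assume *: "(a \<otimes> g, b \<otimes> g) \<in> parcs K"
  have "a = (a \<otimes> g) \<otimes> inv g" "b = (b \<otimes> g) \<otimes> inv g" using assms by (simp_all add: m_assoc)
  with * show "(a, b) \<in> parcs (translate G g K)"
    unfolding translate_def by (simp add: image_iff) (metis (no_types, lifting) case_prod_conv)
qed

lemma (in group) subgraph_space_arcs_carrier:
  "K \<in> subgraph_space G S \<Longrightarrow> parcs K \<subseteq> carrier G \<times> carrier G"
  by (auto simp: subgraph_space_iff)

lemma (in group) translate_mem_subgraph_space:
  assumes K: "K \<in> subgraph_space G S" and g: "g \<in> pverts K"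
  shows "translate G g K \<in> subgraph_space G S"
proof -
  let ?t = "\<lambda>x. x \<otimes> inv g"
  have gc: "g \<in> carrier G" using K g by (auto simp: subgraph_space_iff)
  have arcs: "parcs (translate G g K) = (\<lambda>(x, y). (?t x, ?t y)) ` parcs K"
    and verts: "pverts (translate G g K) = ?t ` pverts K" by (simp_all add: translate_def)
  have img: "(?t x, ?t y) \<in> (parcs (translate G g K))\<^sup>*" if "(x, y) \<in> (parcs K)\<^sup>*" for x y
    using that
  proof (induction rule: rtrancl_induct)
    case (step y z)
    then have "(?t y, ?t z) \<in> parcs (translate G g K)" unfolding arcs by force
    with step.IH show ?case by (rule rtrancl_into_rtrancl)
  qed simp
  have one: "\<one> = ?t g" using gc by simp
  have sub: "pverts (translate G g K) \<subseteq> carrier G"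
    using K gc by (auto simp: subgraph_space_iff verts)
  have cay: "parcs (translate G g K) \<subseteq> parcs (cayley_graph G S)"
  proof
    fix e assume "e \<in> parcs (translate G g K)"
    then obtain x y where xy: "e = (?t x, ?t y)" "(x, y) \<in> parcs K" by (auto simp: arcs)
    then have "x \<in> carrier G" "y \<in> carrier G" "y \<otimes> inv x \<in> S"
      using K unfolding subgraph_space_iff by (auto simp: cayley_arc_iff)
    then show "e \<in> parcs (cayley_graph G S)"
      using gc by (simp add: xy(1) cayley_arc_iff right_translate_quotient)
  qed
  have sym: "sym (parcs (translate G g K))"
  proof (rule symI)
    fix a b assume "(a, b) \<in> parcs (translate G g K)"
    then obtain x y where "(x, y) \<in> parcs K" "a = ?t x" "b = ?t y" by (auto simp: arcs)
    moreover from this have "(y, x) \<in> parcs K" using K by (meson subgraph_space_iff symD)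
    ultimately show "(b, a) \<in> parcs (translate G g K)" unfolding arcs by force
  qed
  have wf: "parcs (translate G g K) \<subseteq> pverts (translate G g K) \<times> pverts (translate G g K)"
    using K by (auto simp: subgraph_space_iff arcs verts)
  have con: "(\<one>, v) \<in> (parcs (translate G g K))\<^sup>*" if "v \<in> pverts (translate G g K)" for v
  proof -
    obtain x where x: "x \<in> pverts K" "v = ?t x"
      using \<open>v \<in> pverts (translate G g K)\<close> verts by auto
    then have "(\<one>, x) \<in> (parcs K)\<^sup>*" "(\<one>, g) \<in> (parcs K)\<^sup>*" "sym (parcs K)"
      using K g by (auto simp: subgraph_space_iff)
    then have "(g, x) \<in> (parcs K)\<^sup>*" by (meson rtrancl_trans sym_rtrancl symD)
    from img[OF this] show ?thesis using one x(2) by simp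
  qed
  have "\<one> \<in> pverts (translate G g K)" using one g verts by auto
  with sub cay sym wf con show ?thesis by (simp add: subgraph_space_iff)
qed

text \<open>
  A translate by \<open>g\<close> contains \<open>\<one>\<close> only when \<open>g\<close> is a vertex. This parametrisation of orbits by
  vertices relates the size of an orbit to that of the graph.
\<close>

lemma (in group) orbit_eq_translates:
  assumes K: "K \<in> subgraph_space G S"
  shows "orbit_rel G S `` {K} = (\<lambda>g. translate G g K) ` pverts K"
proof (intro equalityI subsetI)
  fix L assume "L \<in> orbit_rel G S `` {K}"
  then obtain g where g: "g \<in> carrier G" "L = translate G g K" "L \<in> subgraph_space G S"
    by (auto simp: orbit_rel_def)
  then have "\<one> \<in> pverts (translate G g K)" by (simp add: subgraph_space_iff)
  then obtain x where x: "x \<in> pverts K" "\<one> = x \<otimes> inv g" by (auto simp: translate_def)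
  then have "x \<in> carrier G" using K by (auto simp: subgraph_space_iff)
  with x g have "x = g" by (metis inv_closed inv_equality inv_inv)
  with x g show "L \<in> (\<lambda>g. translate G g K) ` pverts K" by blast
next
  fix L assume "L \<in> (\<lambda>g. translate G g K) ` pverts K"
  then show "L \<in> orbit_rel G S `` {K}"
    using K translate_mem_subgraph_space[OF K] subgraph_space_iff[of K S]
    by (auto simp: orbit_rel_def)
qed

lemma (in group) translate_one:
  assumes "K \<in> subgraph_space G S"
  shows "translate G \<one> K = K"
proof -
  have "x \<otimes> inv \<one> = x" if "x \<in> pverts K" for x
    using that assms by (auto simp: subgraph_space_iff)
  moreover have "(\<lambda>(x, y). (x \<otimes> inv \<one>, y \<otimes> inv \<one>)) e = e" if "e \<in> parcs K" for e
    using that subgraph_space_arcs_carrier[OF assms] by (auto simp: split_beta)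
  ultimately show ?thesis by (simp add: translate_def)
qed

lemma (in group) mem_orbit_self:
  "K \<in> subgraph_space G S \<Longrightarrow> K \<in> orbit_rel G S `` {K}"
  by (auto simp: orbit_rel_def translate_one intro!: bexI[of _ \<one>])

lemma (in group) translate_cayley:
  assumes "g \<in> carrier G"
  shows "translate G g (cayley_graph G S) = cayley_graph G S"
proof -
  have "(\<lambda>x. x \<otimes> inv g) ` carrier G = carrier G"
  proof
    show "carrier G \<subseteq> (\<lambda>x. x \<otimes> inv g) ` carrier G"
    proof
      fix x assume "x \<in> carrier G"
      then have "x = (x \<otimes> g) \<otimes> inv g" "x \<otimes> g \<in> carrier G" using assms by (simp_all add: m_assoc)
      then show "x \<in> (\<lambda>x. x \<otimes> inv g) ` carrier G" by blast
    qed
  qed (use assms in auto)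
  moreover have "parcs (translate G g (cayley_graph G S)) = parcs (cayley_graph G S)" (is "?L = ?R")
  proof -
    have car: "?R \<subseteq> carrier G \<times> carrier G" by (auto simp: cayley_arc_iff)
    then have "?L \<subseteq> carrier G \<times> carrier G" using assms by (auto simp: translate_def)
    moreover have "(a, b) \<in> ?L \<longleftrightarrow> (a, b) \<in> ?R" if "a \<in> carrier G" "b \<in> carrier G" for a b
    proof -
      have "b \<otimes> g \<otimes> inv (a \<otimes> g) = b \<otimes> inv a"
        using that assms by (simp add: right_translate_quotient)
      then show ?thesis
        using that assms translate_arc_iff[OF assms car that] by (simp add: cayley_arc_iff)
    qed
    ultimately show ?thesis using car by auto
  qed
  ultimately show ?thesis by (simp add: translate_def cayley_graph_def)
qed

lemma (in group) cayley_notin_proper_minimal_set: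
  assumes min: "minimal_set G S Z" and H: "H \<in> Z" "H \<noteq> cayley_graph G S"
  shows "cayley_graph G S \<notin> Z"
proof
  interpret M: Metric_space "subgraph_space G S" "gh_dist \<one>" by (rule Metric_space_subgraph_space)
  assume c: "cayley_graph G S \<in> Z"
  have "Z \<subseteq> subgraph_space G S"
    using min closedin_subset unfolding minimal_set_def gh_topology_def by fastforce
  with c have C: "cayley_graph G S \<in> subgraph_space G S" by blast
  have "orbit_rel G S `` {cayley_graph G S} = {cayley_graph G S}"
    unfolding orbit_eq_translates[OF C] using translate_cayley
    by (auto simp: cayley_graph_def)
  moreover have "closedin M.mtopology {cayley_graph G S}"
    using C M.t1_space_mtopology by (simp add: t1_space_closedin_singleton)
  ultimately have "gh_topology G S closure_of (orbit_rel G S `` {cayley_graph G S}) = {cayley_graph G S}"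
    by (simp add: gh_topology_def closure_of_eq)
  with min c have "Z \<subseteq> {cayley_graph G S}" unfolding minimal_set_def by blast
  with H show False by blast
qed

section \<open>Insertion\<close>

lemma (in group) insertion_eq:
  assumes "parcs K \<union> F \<subseteq> carrier G \<times> carrier G"
  shows "insertion G F K = pair_induce \<lparr> pverts = carrier G, parcs = parcs K \<union> F \<rparr>
           {v. (\<one>, v) \<in> (parcs K \<union> F)\<^sup>*}"
proof -
  let ?X = "\<lparr> pverts = carrier G, parcs = parcs K \<union> F \<rparr>"
  have "\<one> \<rightarrow>\<^sup>*\<^bsub>with_proj ?X\<^esub> v \<longleftrightarrow> (\<one>, v) \<in> (parcs K \<union> F)\<^sup>*" for v
    using reachable_with_proj_iff[of ?X \<one> v] assms by simp
  then have "Collect (reachable (with_proj ?X) \<one>) = {v. (\<one>, v) \<in> (parcs K \<union> F)\<^sup>*}" by blast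
  then show ?thesis by (simp add: insertion_def Let_def)
qed

lemma (in group)
  assumes K: "K \<in> subgraph_space G S" and F: "F \<subseteq> parcs (cayley_graph G S)"
  shows pverts_insertion: "pverts (insertion G F K) = {v. (\<one>, v) \<in> (parcs K \<union> F)\<^sup>*}"
    and parcs_insertion: "parcs (insertion G F K) = {e \<in> parcs K \<union> F. (\<one>, fst e) \<in> (parcs K \<union> F)\<^sup>*}"
proof -
  have "F \<subseteq> carrier G \<times> carrier G" using F by (auto simp: cayley_graph_def)
  then have *: "parcs K \<union> F \<subseteq> carrier G \<times> carrier G" using subgraph_space_arcs_carrier[OF K] by blast
  show "pverts (insertion G F K) = {v. (\<one>, v) \<in> (parcs K \<union> F)\<^sup>*}"
    unfolding insertion_eq[OF *] by (simp add: pair_induce_def)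
  show "parcs (insertion G F K) = {e \<in> parcs K \<union> F. (\<one>, fst e) \<in> (parcs K \<union> F)\<^sup>*}"
    unfolding insertion_eq[OF *] 
    by (auto simp: pair_induce_def intro: rtrancl_into_rtrancl simp del: Un_iff)
qed

text \<open>
  A walk from \<open>\<one>\<close> in the enlarged graph never leaves the component of \<open>\<one>\<close>, so the component is
  connected by its own arcs.
\<close>

lemma (in group) insertion_mem_subgraph_space:
  assumes K: "K \<in> subgraph_space G S" and F: "F \<subseteq> parcs (cayley_graph G S)" "sym F"
  shows "insertion G F K \<in> subgraph_space G S"
proof -
  let ?X = "parcs K \<union> F" and ?L = "insertion G F K"
  note V = pverts_insertion[OF K F(1)] and A = parcs_insertion[OF K F(1)]
  have X: "?X \<subseteq> parcs (cayley_graph G S)" "sym ?X"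
    using K F by (auto simp: subgraph_space_iff sym_Un)
  have carr: "v \<in> carrier G" if "(\<one>, v) \<in> ?X\<^sup>*" for v
    using that
  proof (induction rule: rtrancl_induct)
    case (step y z)
    then show ?case using subsetD[OF X(1), of "(y, z)"] by (simp add: cayley_arc_iff)
  qed simp
  have con: "(\<one>, v) \<in> (parcs ?L)\<^sup>*" if "(\<one>, v) \<in> ?X\<^sup>*" for v
    using that
  proof (induction rule: rtrancl_induct)
    case (step y z)
    then have "(y, z) \<in> parcs ?L" by (simp add: A)
    with step.IH show ?case by (rule rtrancl_into_rtrancl)
  qed simp
  have "parcs ?L \<subseteq> pverts ?L \<times> pverts ?L"
    unfolding A V by (auto simp del: Un_iff intro: rtrancl_into_rtrancl)
  moreover have "sym (parcs ?L)"
  proof (rule symI)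
    fix a b assume "(a, b) \<in> parcs ?L"
    then have "(a, b) \<in> ?X" "(\<one>, a) \<in> ?X\<^sup>*" by (auto simp: A)
    moreover from this have "(\<one>, b) \<in> ?X\<^sup>*" by (meson rtrancl_into_rtrancl)
    ultimately show "(b, a) \<in> parcs ?L" using symD[OF X(2)] by (simp add: A del: Un_iff)
  qed
  ultimately show ?thesis
    using X(1) carr con by (auto simp: subgraph_space_iff V A)
qed

lemma (in group) subset_parcs_insertion:
  assumes K: "K \<in> subgraph_space G S" and F: "F \<subseteq> parcs (cayley_graph G S)"
    and reach: "\<And>e. e \<in> F \<Longrightarrow> (\<one>, fst e) \<in> F\<^sup>*"
  shows "F \<subseteq> parcs (insertion G F K)"
  using reach rtrancl_mono[of F "parcs K \<union> F"] by (auto simp: parcs_insertion[OF K F])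

text \<open>
  An arc \<open>(a, b)\<close> of \<open>F\<close> and the arc of \<open>F\<close> onto which it is moved determine \<open>g\<close>, by cancellation.
\<close>

lemma (in group) finite_right_translates_meeting:
  assumes F: "finite F" "F \<subseteq> carrier G \<times> carrier G"
  shows "finite {g \<in> carrier G. \<exists>(a, b) \<in> F. (a \<otimes> g, b \<otimes> g) \<in> F}" (is "finite ?M")
proof -
  have "?M \<subseteq> (\<lambda>((a, b), (c, d)). inv a \<otimes> c) ` (F \<times> F)"
  proof
    fix g assume "g \<in> ?M"
    then obtain a b where g: "g \<in> carrier G" "(a, b) \<in> F" "(a \<otimes> g, b \<otimes> g) \<in> F" by auto
    then have "a \<in> carrier G" using F(2) by auto
    with g have "g = (\<lambda>((a, b), (c, d)). inv a \<otimes> c) ((a, b), (a \<otimes> g, b \<otimes> g))"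
      by (simp add: m_assoc[symmetric])
    with g show "g \<in> (\<lambda>((a, b), (c, d)). inv a \<otimes> c) ` (F \<times> F)" by blast
  qed
  then show ?thesis using F(1) by (meson finite_SigmaI finite_imageI finite_subset)
qed

text \<open>
  By the pigeonhole principle infinitely many vertices \<open>v\<close> give the same translate as one vertex
  \<open>h\<close>. Each quotient \<open>h\<^sup>-\<^sup>1v\<close> is then a period of \<open>L\<close>, and carries \<open>F\<close> to another copy of it.
\<close>

lemma (in group) recurring_pattern_if_finite_orbit:
  assumes L: "L \<in> subgraph_space G S" and FL: "F \<subseteq> parcs L"
    and inf: "infinite (pverts L)" and fin: "finite (orbit_rel G S `` {L})"
  shows "infinite {g \<in> carrier G. \<forall>(a, b) \<in> F. (a \<otimes> g, b \<otimes> g) \<in> parcs L}" (is "infinite ?P")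
proof
  assume P: "finite ?P"
  have arcs: "parcs L \<subseteq> carrier G \<times> carrier G" by (rule subgraph_space_arcs_carrier[OF L])
  have V: "pverts L \<subseteq> carrier G" using L by (simp add: subgraph_space_iff)
  have "finite ((\<lambda>g. translate G g L) ` pverts L)" using fin orbit_eq_translates[OF L] by simp
  from pigeonhole_infinite[OF inf this] obtain h
    where h: "h \<in> pverts L" "infinite {v \<in> pverts L. translate G v L = translate G h L}" by blast
  have "{v \<in> pverts L. translate G v L = translate G h L} \<subseteq> (\<lambda>g. h \<otimes> g) ` ?P"
  proof
    fix v assume "v \<in> {v \<in> pverts L. translate G v L = translate G h L}"
    then have v: "v \<in> carrier G" "translate G v L = translate G h L" using V by auto
    have hc: "h \<in> carrier G" using h(1) V by blast
    have "(a \<otimes> (inv h \<otimes> v), b \<otimes> (inv h \<otimes> v)) \<in> parcs L" if "(a, b) \<in> F" for a b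
    proof -
      have ab: "a \<in> carrier G" "b \<in> carrier G" "(a, b) \<in> parcs L" using that FL arcs by auto
      then have "(a \<otimes> inv h, b \<otimes> inv h) \<in> parcs (translate G h L)"
        using hc by (subst translate_arc_iff[OF hc arcs]) (simp_all add: m_assoc)
      then have "(a \<otimes> inv h \<otimes> v, b \<otimes> inv h \<otimes> v) \<in> parcs L"
        using ab hc v translate_arc_iff[OF v(1) arcs] by (metis inv_closed m_closed)
      then show ?thesis using ab hc v(1) by (simp add: m_assoc)
    qed
    then have "inv h \<otimes> v \<in> ?P" using hc v(1) by auto
    moreover have "v = h \<otimes> (inv h \<otimes> v)" using hc v(1) by (simp add: m_assoc[symmetric])
    ultimately show "v \<in> (\<lambda>g. h \<otimes> g) ` ?P" by blast
  qed
  with P h(2) show False by (meson finite_imageI finite_subset)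
qed

text \<open>
  If the orbit became finite, some copy \<open>Fg\<close> in the new graph would avoid the inserted arcs \<open>F\<close> and
  hence lie in \<open>K\<close>. Connectedness of \<open>F\<close> to \<open>\<one>\<close> serves twice: all of \<open>F\<close> survives the passage to the
  component of \<open>\<one>\<close>, and \<open>F\<close> has an arc at \<open>\<one>\<close>, so that \<open>g\<close> is a vertex of \<open>K\<close>.
\<close>

lemma (in group) infinite_orbit_insertion:
  assumes K: "K \<in> infinite_states G S"
    and F: "F \<subseteq> parcs (cayley_graph G S)" "sym F" "finite F" "F \<noteq> {}"
    and reach: "\<And>e. e \<in> F \<Longrightarrow> (\<one>, fst e) \<in> F\<^sup>*"
    and avoid: "\<And>g. g \<in> pverts K \<Longrightarrow> \<not> F \<subseteq> parcs (translate G g K)"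
  shows "insertion G F K \<in> infinite_states G S"
proof (rule ccontr)
  let ?L = "insertion G F K"
  have K': "K \<in> subgraph_space G S" "infinite (orbit_rel G S `` {K})"
    using K by (auto simp: infinite_states_def)
  have L: "?L \<in> subgraph_space G S" by (rule insertion_mem_subgraph_space[OF K'(1) F(1,2)])
  assume "?L \<notin> infinite_states G S"
  then have fin: "finite (orbit_rel G S `` {?L})" using L by (simp add: infinite_states_def)
  have "infinite (pverts K)" using K'(2) orbit_eq_translates[OF K'(1)] by auto
  moreover have "pverts K \<subseteq> pverts ?L"
  proof
    fix v assume "v \<in> pverts K"
    then have "(\<one>, v) \<in> (parcs K)\<^sup>*" using K'(1) by (simp add: subgraph_space_iff)
    then show "v \<in> pverts ?L"
      unfolding pverts_insertion[OF K'(1) F(1)] using rtrancl_mono[of "parcs K" "parcs K \<union> F"] by blast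
  qed
  ultimately have inf: "infinite (pverts ?L)" using finite_subset by blast
  have Fc: "F \<subseteq> carrier G \<times> carrier G" using F(1) by (auto simp: cayley_graph_def)
  have FL: "F \<subseteq> parcs ?L" by (rule subset_parcs_insertion[OF K'(1) F(1) reach])
  have "\<not> {g \<in> carrier G. \<forall>(a, b) \<in> F. (a \<otimes> g, b \<otimes> g) \<in> parcs ?L}
          \<subseteq> {g \<in> carrier G. \<exists>(a, b) \<in> F. (a \<otimes> g, b \<otimes> g) \<in> F}"
    using recurring_pattern_if_finite_orbit[OF L FL inf fin] finite_right_translates_meeting[OF F(3) Fc]
      finite_subset by blast
  then obtain g where g: "g \<in> carrier G" "\<And>a b. (a, b) \<in> F \<Longrightarrow> (a \<otimes> g, b \<otimes> g) \<in> parcs ?L"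
    "\<And>a b. (a, b) \<in> F \<Longrightarrow> (a \<otimes> g, b \<otimes> g) \<notin> F" by blast
  have FK: "(a \<otimes> g, b \<otimes> g) \<in> parcs K" if "(a, b) \<in> F" for a b
    using g(2,3)[OF that] by (auto simp: parcs_insertion[OF K'(1) F(1)])
  \<comment> \<open>The first arc of a walk in \<open>F\<close> that ends with any given arc of \<open>F\<close>.\<close>
  obtain x where x: "(\<one>, x) \<in> F"
  proof -
    obtain a b where ab: "(a, b) \<in> F" using F(4) by auto
    then have "(\<one>, a) \<in> F\<^sup>*" using reach by fastforce
    then show ?thesis using ab that by (cases rule: converse_rtranclE) auto
  qed
  have "g \<in> pverts K"
    using FK[OF x] K'(1) g(1) by (auto simp: subgraph_space_iff)
  moreover have "F \<subseteq> parcs (translate G g K)"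
  proof
    fix e assume e: "e \<in> F"
    obtain a b where ab: "e = (a, b)" by fastforce
    have "a \<in> carrier G" "b \<in> carrier G" using e ab Fc by auto
    then show "e \<in> parcs (translate G g K)"
      using FK e ab translate_arc_iff[OF g(1) subgraph_space_arcs_carrier[OF K'(1)]] by simp
  qed
  ultimately show False using avoid by blast
qed

section \<open>The singularity theorem\<close>

theorem theorem3p2:
  fixes G :: "('a, 'm) monoid_scheme" (structure)
    and S :: "'a set"
    and \<mu> :: "'a pair_pre_digraph measure"
    and H :: "'a pair_pre_digraph"
  assumes "group G" and "countable (carrier G)"
    and "finite S" and "S \<subseteq> carrier G" and "\<And>s. s \<in> S \<Longrightarrow> inv s \<in> S"
    and "generate G S = carrier G"
    and "borel_prob G S \<mu>"
    and "quasi_invariant G S \<mu>"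
    and "insertion_tolerant G S \<mu>"
    and "emeasure \<mu> (infinite_states G S) > 0"
    and "ergodic G S (uniform_measure \<mu> (infinite_states G S))"
    and "H \<in> subgraph_space G S" and "H \<noteq> cayley_graph G S"
    and "repetitive G S H"
  shows "emeasure (uniform_measure \<mu> (infinite_states G S)) (orbit_closure G S H) = 0
    \<and> (\<forall>\<nu>. borel_prob G S \<nu> \<and> emeasure \<nu> (orbit_closure G S H) = 1
         \<longrightarrow> mutually_singular (uniform_measure \<mu> (infinite_states G S)) \<nu>)"
proof -
  interpret group G by fact
  interpret \<mu>: prob_space \<mu> using assms(7) by (simp add: borel_prob_def)
  let ?I = "infinite_states G S"
  let ?\<mu>I = "uniform_measure \<mu> ?I"
  define Z where "Z = orbit_closure G S H"
  have top: "topspace (gh_topology G S) = subgraph_space G S"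
    unfolding gh_topology_def by (rule Metric_space.topspace_mtopology[OF Metric_space_subgraph_space])
  have min: "minimal_set G S Z" using assms(14) by (simp add: repetitive_def Z_def)
  then have cl: "closedin (gh_topology G S) Z" by (simp add: minimal_set_def)
  then have Zsub: "Z \<subseteq> subgraph_space G S" using closedin_subset top by metis
  have inv: "translate G g K \<in> Z" if "K \<in> Z" "g \<in> pverts K" for K g
    using min that Zsub orbit_eq_translates[of K S] by (auto simp: minimal_set_def)
  have "orbit_rel G S `` {H} \<subseteq> subgraph_space G S" by (auto simp: orbit_rel_def)
  then have HZ: "H \<in> Z"
    unfolding Z_def orbit_closure_def
    using mem_orbit_self[OF assms(12)] closure_of_subset top by (metis subsetD)
  have sets: "sets \<mu> = sets (gh_borel G S)" using assms(7) by (simp add: borel_prob_def)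
  have Zborel: "Z \<in> sets (gh_borel G S)"
  proof -
    have "openin (gh_topology G S) (subgraph_space G S - Z)" using cl top by (metis closedin_def)
    then have "subgraph_space G S - Z \<in> sets (gh_borel G S)"
      unfolding gh_borel_def using openin_subset top by (subst sets_measure_of) auto
    then have "space (gh_borel G S) - (subgraph_space G S - Z) \<in> sets (gh_borel G S)" by blast
    moreover have "space (gh_borel G S) = subgraph_space G S"
      unfolding gh_borel_def using openin_subset[of "gh_topology G S"] top by (subst space_measure_of) auto
    ultimately show ?thesis using Zsub by (simp add: double_diff)
  qed
  \<comment> \<open>Sets outside the \<open>\<sigma>\<close>-algebra have measure \<open>0\<close>, so positive measure entails measurability.\<close>
  have Iset: "?I \<in> sets \<mu>" using assms(10) emeasure_notin_sets by fastforce
  have Zset: "Z \<in> sets \<mu>" using Zborel sets by simp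

  have "cayley_graph G S \<notin> Z" by (rule cayley_notin_proper_minimal_set[OF min HZ assms(13)])
  then obtain n :: nat where n: "\<And>K. K \<in> Z \<Longrightarrow> \<not> parcs (gball (cayley_graph G S) \<one> (real n)) \<subseteq> parcs K"
    using closed_set_avoids_ball[OF cl cayley_mem_subgraph_space[OF assms(4,5,6)]] by blast
  define F where "F = parcs (gball (cayley_graph G S) \<one> (real n))"
  have F: "finite F" "sym F" "F \<subseteq> parcs (cayley_graph G S)"
    unfolding F_def
    by (rule finite_cayley_ball[OF assms(3)], rule sym_gball[OF sym_cayley[OF assms(5)]])
      (auto simp: gball_def pair_induce_def)
  have reach: "(\<one>, fst e) \<in> F\<^sup>*" if "e \<in> F" for e
    using that unfolding F_def by (rule gball_arc_reachable)
  have avoid: "\<not> F \<subseteq> parcs K" if "K \<in> Z" for K using n[OF that] by (simp add: F_def)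
  then have "F \<noteq> {}" using HZ by blast
  have ins: "insertion G F ` (?I \<inter> Z) \<subseteq> ?I - Z"
  proof (intro image_subsetI DiffI)
    fix K assume K: "K \<in> ?I \<inter> Z"
    show "insertion G F K \<in> ?I"
      using K inv avoid F reach \<open>F \<noteq> {}\<close> by (intro infinite_orbit_insertion) auto
    show "insertion G F K \<notin> Z"
      using K Zsub avoid subset_parcs_insertion[OF _ F(3) reach] by blast
  qed

  have null: "emeasure ?\<mu>I Z = 0"
  proof (rule ccontr)
    assume nz: "emeasure ?\<mu>I Z \<noteq> 0"
    have "orbit_rel G S `` Z = Z"
      using min Zsub mem_orbit_self by (auto simp: minimal_set_def)
    then have "emeasure ?\<mu>I Z = 1"
      using assms(11) Zborel nz unfolding ergodic_def by force
    interpret \<mu>I: prob_space ?\<mu>I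
      using assms(10) by (intro prob_space_uniform_measure) (auto simp: \<mu>.emeasure_eq_measure)
    have "emeasure ?\<mu>I (space ?\<mu>I - Z) = 0"
      using \<mu>I.emeasure_space_1 \<open>emeasure ?\<mu>I Z = 1\<close> Zset by (subst emeasure_compl) auto
    then have "emeasure \<mu> (?I \<inter> (space \<mu> - Z)) / emeasure \<mu> ?I = 0"
      using Zset Iset by simp
    then have "emeasure \<mu> (?I \<inter> (space \<mu> - Z)) = 0"
      by (simp add: ennreal_divide_eq_0_iff)
    moreover have "?I \<inter> (space \<mu> - Z) = ?I - Z" using Iset sets.sets_into_space by blast
    ultimately have "emeasure \<mu> (?I - Z) = 0" by simp
    then have "emeasure \<mu> (insertion G F ` (?I \<inter> Z)) = 0"
      using emeasure_mono[OF ins, of \<mu>] Iset Zset by simp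
    moreover have "emeasure \<mu> (?I \<inter> Z) > 0"
      using nz Iset Zset by (auto simp: zero_less_iff_neq_zero)
    ultimately show False
      using assms(9) F Iset Zset sets unfolding insertion_tolerant_def by (metis less_irrefl sets.Int)
  qed
  moreover have "mutually_singular ?\<mu>I \<nu>" if \<nu>: "borel_prob G S \<nu>" "emeasure \<nu> Z = 1" for \<nu>
  proof -
    interpret \<nu>: prob_space \<nu> using \<nu>(1) by (simp add: borel_prob_def)
    have Z\<nu>: "Z \<in> sets \<nu>" using \<nu>(1) Zborel by (simp add: borel_prob_def)
    have "emeasure \<nu> (space \<nu> - Z) = 0"
      using \<nu>.emeasure_space_1 \<nu>(2) Z\<nu> by (subst emeasure_compl) auto
    then show ?thesis using null Zset Z\<nu> unfolding mutually_singular_def by auto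
  qed
  ultimately show ?thesis unfolding Z_def by blast
qed

end
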